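(* For every integer $n\ge 3$, the bipartite wheel $BW_n$ has cop number $$c(BW_n)=2 .$$
   Context: For $n\ge3$, the bipartite wheel (gear graph) $BW_n$ is obtained from the wheel consisting of a cycle $\langle u_1,\dots,u_n,u_1\rangle$ and a hub $h$ adjacent to every $u_i$ by subdividing every rim edge exactly once. Explicitly, with indices modulo $n$, $V(BW_n)=\{h\}\cup\{u_i,v_i:1\le i\le n\}$ and $E(BW_n)=\{hu_i,\,u_iv_i,\,v_iu_{i+1}:1\le i\le n\}$. Cops and Robbers: on a connected graph, the cops first choose initial vertices (several cops may share a vertex), then the robber chooses an initial vertex. The sides then move alternately, cops first; on the cops' turn every cop, and on the robber's turn the robber, either stays or moves to an adjacent vertex. All positions are visible to all players. The cops win if at some time a cop occupies the robber's vertex; the robber wins if he evades capture forever. The cop number $c(G)$ is the minimum number of cops that guarantees capture on $G$. *)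

theory Defs
  imports Main
begin

text \<open>
  A graph is given by its vertex set \<open>V\<close> and its edge set \<open>E\<close>, a set of two-element subsets of \<open>V\<close>.
\<close>

definition can_move :: "'a set set \<Rightarrow> 'a \<Rightarrow> 'a \<Rightarrow> bool" where
  "can_move E x y \<longleftrightarrow> y = x \<or> {x, y} \<in> E"

text \<open>
  In round \<open>t\<close> the cops are on \<open>c t\<close> (the \<open>i\<close>-th entry being the vertex of the \<open>i\<close>-th cop) when the
  robber goes to \<open>r t\<close>. Thus \<open>c 0\<close> and \<open>r 0\<close> are the initial placements, and the order of
  play is \<open>c 0\<close>, \<open>r 0\<close>, \<open>c 1\<close>, \<open>r 1\<close>, and so on.
\<close>

definition legal_robber :: "'a set \<Rightarrow> 'a set set \<Rightarrow> (nat \<Rightarrow> 'a) \<Rightarrow> bool" where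
  "legal_robber V E r \<longleftrightarrow> (\<forall>t. r t \<in> V) \<and> (\<forall>t. can_move E (r t) (r (Suc t)))"

definition legal_cops :: "'a set \<Rightarrow> 'a set set \<Rightarrow> nat \<Rightarrow> (nat \<Rightarrow> 'a list) \<Rightarrow> bool" where
  "legal_cops V E k c \<longleftrightarrow>
     (\<forall>t. length (c t) = k \<and> set (c t) \<subseteq> V) \<and>
     (\<forall>t. list_all2 (can_move E) (c t) (c (Suc t)))"

text \<open>
  Capture happens either on a robber move (first disjunct) or on a cop move (second disjunct).
  Play formally continues after a capture; this is harmless, since everybody may stay put.
\<close>

definition captured :: "(nat \<Rightarrow> 'a list) \<Rightarrow> (nat \<Rightarrow> 'a) \<Rightarrow> bool" where
  "captured c r \<longleftrightarrow> (\<exists>t. r t \<in> set (c t) \<or> r t \<in> set (c (Suc t)))"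

text \<open>
  A cop strategy maps the list of the robber's past positions (oldest first) to the next positions
  of the cops; on the empty list it gives the initial placement. The cops' own past
  positions need not be an argument, as they are determined by the strategy and the robber's
  past.
\<close>

definition cop_response :: "('a list \<Rightarrow> 'a list) \<Rightarrow> (nat \<Rightarrow> 'a) \<Rightarrow> nat \<Rightarrow> 'a list" where
  "cop_response s r t = s (map r [0..<t])"

definition cops_win :: "'a set \<Rightarrow> 'a set set \<Rightarrow> nat \<Rightarrow> bool" where
  "cops_win V E k \<longleftrightarrow>
     (\<exists>s. \<forall>r. legal_robber V E r \<longrightarrow>
        legal_cops V E k (cop_response s r) \<and> captured (cop_response s r) r)"

text \<open>
  On a finite graph some number of cops always wins, by occupying every vertex.
\<close>

definition cop_number :: "'a set \<Rightarrow> 'a set set \<Rightarrow> nat" where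
  "cop_number V E = (LEAST k. cops_win V E k)"

text \<open>
  \<open>U i\<close> is the rim vertex \<open>u\<^sub>i\<close> of the wheel and \<open>V i\<close> the subdividing vertex \<open>v\<^sub>i\<close>. Indices are
  the representatives \<open>1, \<dots>, n\<close> modulo \<open>n\<close>, so the cyclic successor of \<open>i\<close> is \<open>i mod n + 1\<close>.
\<close>

datatype gear_vertex = Hub | U nat | V nat

definition BW_verts :: "nat \<Rightarrow> gear_vertex set" where
  "BW_verts n = {Hub} \<union> U ` {1..n} \<union> V ` {1..n}"

definition BW_edges :: "nat \<Rightarrow> gear_vertex set set" where
  "BW_edges n =
     (\<Union>i\<in>{1..n}. {{Hub, U i}, {U i, V i}, {V i, U (i mod n + 1)}})"

end

theory Submission
  imports Defs
begin

text \<open>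
  One cop does not suffice on a triangle-free graph of minimum degree at least two: no closed
  neighbourhood is contained in another one, so a threatened robber always has a safe move. Two
  cops suffice on the gear graph: with a cop on the hub, the robber is lost on every \<open>U i\<close>, hence
  he starts on some \<open>V i\<close> and cannot leave it while the other cop walks there via \<open>U i\<close>.
\<close>

lemma not_cops_win_0:
  assumes "W \<noteq> {}"
  shows "\<not> cops_win W E 0"
proof
  assume "cops_win W E 0"
  then obtain s where s: "\<And>r. legal_robber W E r \<Longrightarrow>
      legal_cops W E 0 (cop_response s r) \<and> captured (cop_response s r) r"
    unfolding cops_win_def by blast
  obtain v where "v \<in> W" using assms by blast
  then have "legal_robber W E (\<lambda>_. v)" by (simp add: legal_robber_def can_move_def)
  from s[OF this] show False
    by (auto simp: legal_cops_def captured_def)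
qed

text \<open>The robber keeps the invariant that after each cop move he is not on the cop's vertex.
  \<open>no_corner\<close> then lets him leave, or stay outside, the closed neighbourhood of the
  cop, so the next cop move cannot reach him either.\<close>

lemma not_cops_win_1_if_no_corner:
  assumes ab: "a \<in> W" "b \<in> W" "a \<noteq> b"
    and no_corner: "\<And>x y. x \<in> W \<Longrightarrow> y \<in> W \<Longrightarrow> x \<noteq> y \<Longrightarrow>
      \<exists>z\<in>W. can_move E x z \<and> \<not> can_move E y z"
  shows "\<not> cops_win W E 1"
proof
  assume "cops_win W E 1"
  then obtain s where s: "\<And>r. legal_robber W E r \<Longrightarrow>
      legal_cops W E 1 (cop_response s r) \<and> captured (cop_response s r) r"
    unfolding cops_win_def by blast
  define safe where "safe x y z \<longleftrightarrow> z \<in> W \<and> can_move E x z \<and> \<not> can_move E y z" for x y z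
  \<comment> \<open>The default \<open>x\<close> keeps the robber legal whatever \<open>s\<close>
    answers. This matters because the cops' legality may only be used once the robber's has been
    shown.\<close>
  define step where "step x y = (if \<exists>z. safe x y z then SOME z. safe x y z else x)" for x y
  have step: "safe x y (step x y)" if "\<exists>z. safe x y z" for x y
    using someI_ex[OF that] that by (simp add: step_def)
  have step_legal: "step x y \<in> W \<and> can_move E x (step x y)" if "x \<in> W" for x y
  proof (cases "\<exists>z. safe x y z")
    case True
    from step[OF this] show ?thesis by (simp add: safe_def)
  next
    case False
    then have "step x y = x" unfolding step_def by (rule if_not_P)
    with that show ?thesis by (simp add: can_move_def)
  qed
  obtain x0 where x0: "x0 \<in> W" "x0 \<noteq> hd (s [])" using ab by metis
  \<comment> \<open>The robber's first placement is treated as a move from the fictitious position \<open>x0\<close>.\<close>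
  define prev where "prev h = (if h = [] then x0 else last h)" for h
  define nxt where "nxt h = step (prev h) (hd (s h))" for h
  \<comment> \<open>The cop's position depends on all earlier robber positions, so the recursion
    builds the whole history; \<open>r\<close> is read off from it.\<close>
  define H where "H = rec_nat [] (\<lambda>_ h. h @ [nxt h])"
  define r where "r t = nxt (H t)" for t
  have H0: "H 0 = []" and HS: "H (Suc t) = H t @ [r t]" for t
    by (simp_all add: H_def r_def)
  have Hmap: "map r [0..<t] = H t" for t
    by (induction t) (simp_all add: H0 HS)
  have prev_Suc: "prev (H (Suc t)) = r t" for t by (simp add: prev_def HS)
  have r_step: "r t = step (prev (H t)) (hd (s (H t)))" for t by (simp add: r_def nxt_def)
  have prev_V: "prev (H t) \<in> W" for t
  proof (induction t)
    case 0
    show ?case using x0 by (simp add: H0 prev_def)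
  next
    case (Suc t)
    then show ?case using step_legal by (simp add: prev_Suc r_step)
  qed
  have "legal_robber W E r"
    unfolding legal_robber_def
  proof (intro conjI allI)
    show "r t \<in> W" for t using prev_V[of "Suc t"] by (simp add: prev_Suc)
    show "can_move E (r t) (r (Suc t))" for t
      using step_legal[OF prev_V[of "Suc t"]] by (simp add: prev_Suc r_step[of "Suc t"])
  qed
  from s[OF this] have legal: "legal_cops W E 1 (\<lambda>t. s (H t))"
    and capt: "captured (\<lambda>t. s (H t)) r"
    by (simp_all add: cop_response_def[abs_def] Hmap)
  define c where "c t = hd (s (H t))" for t
  have sc: "s (H t) = [c t]" for t
  proof -
    have "length (s (H t)) = 1" using legal by (simp add: legal_cops_def)
    then show ?thesis by (auto simp: c_def length_Suc_conv)
  qed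
  have c_V: "c t \<in> W" for t
    using legal sc[of t] by (auto simp: legal_cops_def dest!: spec[of _ t])
  have c_move: "can_move E (c t) (c (Suc t))" for t
    using legal sc[of t] sc[of "Suc t"] by (auto simp: legal_cops_def dest!: spec[of _ t])
  \<comment> \<open>\<open>prev (H t)\<close> is where the robber stands when the cop has just
    arrived at \<open>c t\<close>, that is, before the robber moves to \<open>r t\<close>.\<close>
  have escape: "\<not> can_move E (c t) (r t)" if "prev (H t) \<noteq> c t" for t
    using step[of "prev (H t)" "c t"] no_corner[OF prev_V c_V that]
    by (auto simp: safe_def r_step c_def)
  have "prev (H t) \<noteq> c t" for t
  proof (induction t)
    case 0
    show ?case using x0 by (simp add: H0 prev_def c_def)
  next
    case (Suc t)
    from escape[OF this] c_move[of t] show ?case by (auto simp: prev_Suc)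
  qed
  \<comment> \<open>The closed neighbourhood of \<open>c t\<close> contains both \<open>c t\<close>
    and \<open>c (Suc t)\<close>, so both forms of capture are excluded.\<close>
  from escape[OF this] have "r t \<noteq> c t \<and> r t \<noteq> c (Suc t)" for t
    using c_move[of t] by (metis can_move_def)
  with capt show False by (simp add: captured_def sc)
qed

text \<open>If the cop at \<open>y\<close> is adjacent to the robber at \<open>x\<close>, a second
  neighbour of \<open>x\<close> is safe, as an edge from it to \<open>y\<close> would close a
  triangle. Otherwise the robber stays at \<open>x\<close>.\<close>

lemma not_cops_win_1_if_triangle_free:
  assumes "W \<noteq> {}"
    and deg: "\<And>x. x \<in> W \<Longrightarrow> \<exists>y\<in>W. \<exists>z\<in>W. x \<noteq> y \<and> x \<noteq> z \<and> y \<noteq> z \<and> {x, y} \<in> E \<and> {x, z} \<in> E"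
    and triangle_free: "\<And>x y z. {x, y} \<in> E \<Longrightarrow> {x, z} \<in> E \<Longrightarrow> {y, z} \<notin> E"
  shows "\<not> cops_win W E 1"
proof -
  obtain a where "a \<in> W" using assms(1) by blast
  with deg obtain b where "b \<in> W" "a \<noteq> b" by blast
  with \<open>a \<in> W\<close> show ?thesis
  proof (rule not_cops_win_1_if_no_corner)
    fix x y assume xy: "x \<in> W" "y \<in> W" "x \<noteq> y"
    show "\<exists>z\<in>W. can_move E x z \<and> \<not> can_move E y z"
    proof (cases "{x, y} \<in> E")
      case True
      from deg[OF xy(1)] obtain z where "z \<in> W" "z \<noteq> y" "{x, z} \<in> E" by metis
      with triangle_free[OF True] show ?thesis by (auto simp: can_move_def)
    next
      case False
      with xy have "\<not> can_move E y x" by (auto simp: can_move_def insert_commute)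
      with xy(1) show ?thesis by (auto simp: can_move_def)
    qed
  qed
qed

lemma cyclic_succ_mem: "i \<in> {1..n} \<Longrightarrow> i mod n + 1 \<in> {1..n}" for n :: nat
  by (cases "i = n") auto

lemma cyclic_succ_neq: "i \<in> {1..n} \<Longrightarrow> n \<ge> 2 \<Longrightarrow> i mod n + 1 \<noteq> i" for n :: nat
  by (cases "i = n") auto

text \<open>Both orders of each pair are listed because doubletons have no normal form under
  rewriting; the singleton rule handles \<open>{x, x}\<close>.\<close>

lemma BW_edges_simps:
  "{x} \<notin> BW_edges n"
  "{Hub, U i} \<in> BW_edges n \<longleftrightarrow> i \<in> {1..n}"
  "{U i, Hub} \<in> BW_edges n \<longleftrightarrow> i \<in> {1..n}"
  "{Hub, V i} \<notin> BW_edges n"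
  "{V i, Hub} \<notin> BW_edges n"
  "{U i, U j} \<notin> BW_edges n"
  "{V i, V j} \<notin> BW_edges n"
  "{V i, U j} \<in> BW_edges n \<longleftrightarrow> i \<in> {1..n} \<and> (j = i \<or> j = i mod n + 1)"
  "{U j, V i} \<in> BW_edges n \<longleftrightarrow> i \<in> {1..n} \<and> (j = i \<or> j = i mod n + 1)"
  by (auto simp: BW_edges_def doubleton_eq_iff)

text \<open>Every edge joins some \<open>U i\<close> to a vertex of another kind, so the graph is
  bipartite.\<close>

lemma BW_triangle_free:
  "{x, y} \<in> BW_edges n \<Longrightarrow> {x, z} \<in> BW_edges n \<Longrightarrow> {y, z} \<notin> BW_edges n"
  by (cases x; cases y; cases z) (auto simp: BW_edges_simps)

lemma BW_two_neighbours:
  assumes "n \<ge> 2" "x \<in> BW_verts n"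
  shows "\<exists>y\<in>BW_verts n. \<exists>z\<in>BW_verts n. x \<noteq> y \<and> x \<noteq> z \<and> y \<noteq> z \<and>
    {x, y} \<in> BW_edges n \<and> {x, z} \<in> BW_edges n"
proof (cases x)
  case Hub
  then show ?thesis using assms
    by (intro bexI[of _ "U 1"] bexI[of _ "U 2"]) (auto simp: BW_edges_simps BW_verts_def)
next
  case (U i)
  then have "i \<in> {1..n}" using assms by (auto simp: BW_verts_def)
  then show ?thesis using U
    by (intro bexI[of _ Hub] bexI[of _ "V i"]) (auto simp: BW_edges_simps BW_verts_def)
next
  case (V i)
  then have i: "i \<in> {1..n}" using assms by (auto simp: BW_verts_def)
  from cyclic_succ_mem[OF this] cyclic_succ_neq[OF this assms(1)] i show ?thesis using V
    by (intro bexI[of _ "U i"] bexI[of _ "U (i mod n + 1)"])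
      (auto simp: BW_edges_simps BW_verts_def)
qed

text \<open>Capture happens by the second cop move, so at most two robber positions are read and the
  cops then freeze, which keeps them legal forever. The last clause is meant for a robber who stays
  on \<open>V i\<close>.\<close>

fun gear_strategy :: "gear_vertex list \<Rightarrow> gear_vertex list" where
  "gear_strategy [] = [Hub, Hub]"
| "gear_strategy (Hub # _) = [Hub, Hub]"
| "gear_strategy (U i # _) = [U i, Hub]"
| "gear_strategy [V i] = [Hub, U i]"
| "gear_strategy (V i # U j # _) = [U j, U i]"
| "gear_strategy (V i # _ # _) = [Hub, V i]"

lemma gear_strategy_two_rounds: "gear_strategy (x # y # h) = gear_strategy [x, y]"
  by (cases x; cases y) simp_all

lemma cops_win_2_BW: "cops_win (BW_verts n) (BW_edges n) 2"
  unfolding cops_win_def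
proof (intro exI allI impI)
  fix r assume r: "legal_robber (BW_verts n) (BW_edges n) r"
  define c where "c = cop_response gear_strategy r"
  have r_V: "r t \<in> BW_verts n" and r_move: "can_move (BW_edges n) (r t) (r (Suc t))" for t
    using r by (auto simp: legal_robber_def)
  have c0: "c 0 = [Hub, Hub]" by (simp add: c_def cop_response_def)
  have c1: "c (Suc 0) = gear_strategy [r 0]" by (simp add: c_def cop_response_def)
  have upt: "[0..<Suc (Suc t)] = 0 # 1 # [2..<Suc (Suc t)]" for t
    by (metis One_nat_def Suc_1 upt_conv_Cons zero_less_Suc Suc_less_eq)
  have c2: "c (Suc (Suc t)) = gear_strategy [r 0, r 1]" for t
    unfolding c_def cop_response_def upt list.map by (rule gear_strategy_two_rounds)
  have "legal_cops (BW_verts n) (BW_edges n) 2 c \<and> captured c r"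
  proof (cases "r 0")
    case Hub
    then have c: "c t = [Hub, Hub]" for t
      \<comment> \<open>The two case splits separate the rounds 0, 1 and
        \<open>Suc (Suc _)\<close>.\<close>
      using c0 c1 c2 by (cases t; cases "t - 1") auto
    have "captured c r" unfolding captured_def by (rule exI[of _ 0]) (simp add: c Hub)
    then show ?thesis by (simp add: legal_cops_def c can_move_def BW_verts_def)
  next
    case (U i)
    then have i: "i \<in> {1..n}" using r_V[of 0] by (auto simp: BW_verts_def)
    have c: "c (Suc t) = [U i, Hub]" for t
      using c1 c2 U by (cases t) auto
    \<comment> \<open>The capture is by the first cop move: \<open>r 0\<close> lies in
      \<open>c (Suc 0)\<close>.\<close>
    have "captured c r" unfolding captured_def by (rule exI[of _ 0]) (simp add: c U)
    moreover have "length (c t) = 2 \<and> set (c t) \<subseteq> BW_verts n" for t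
      using i by (cases t) (auto simp: c0 c BW_verts_def)
    moreover have "list_all2 (can_move (BW_edges n)) (c t) (c (Suc t))" for t
      using i by (cases t) (auto simp: c0 c can_move_def BW_edges_simps)
    ultimately show ?thesis by (simp add: legal_cops_def)
  next
    case (V i)
    then have i: "i \<in> {1..n}" using r_V[of 0] by (auto simp: BW_verts_def)
    have c1: "c (Suc 0) = [Hub, U i]" using c1 V by simp
    \<comment> \<open>\<open>p\<close> and \<open>q\<close> are the final cop positions. If the
      robber steps to some \<open>U j\<close>, the cop on the hub takes him; if he stays on
      \<open>V i\<close>, the cop on \<open>U i\<close> does.\<close>
    obtain p q where c2: "\<And>t. c (Suc (Suc t)) = [p, q]"
      and p: "p \<in> BW_verts n" "can_move (BW_edges n) Hub p"
      and q: "q \<in> BW_verts n" "can_move (BW_edges n) (U i) q"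
      and pq: "r 1 = p \<or> r 1 = q"
    proof (cases "r 1")
      case Hub
      with r_move[of 0] V show ?thesis by (simp add: can_move_def BW_edges_simps)
    next
      case (U j)
      then have "j \<in> {1..n}" using r_V[of 1] by (auto simp: BW_verts_def)
      with that[of "U j" "U i"] c2 U \<open>r 0 = V i\<close> i show ?thesis
        by (simp add: can_move_def BW_edges_simps BW_verts_def)
    next
      case (V j)
      with r_move[of 0] \<open>r 0 = V i\<close> have "j = i" by (simp add: can_move_def BW_edges_simps)
      with that[of Hub "V i"] c2 V \<open>r 0 = V i\<close> i show ?thesis
        by (simp add: can_move_def BW_edges_simps BW_verts_def)
    qed
    \<comment> \<open>Index 1 works through the second disjunct, since \<open>c 2\<close> is
      \<open>[p, q]\<close>.\<close>
    have "captured c r" unfolding captured_def by (rule exI[of _ 1]) (use pq c2[of 0] in auto)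
    moreover have "length (c t) = 2 \<and> set (c t) \<subseteq> BW_verts n" for t
      using i p q by (cases t; cases "t - 1") (auto simp: c0 c1 c2 BW_verts_def)
    moreover have "list_all2 (can_move (BW_edges n)) (c t) (c (Suc t))" for t
      using i p q by (cases t; cases "t - 1")
        (auto simp: c0 c1 c2 can_move_def BW_edges_simps)
    ultimately show ?thesis by (simp add: legal_cops_def)
  qed
  then show "legal_cops (BW_verts n) (BW_edges n) 2 (cop_response gear_strategy r) \<and>
      captured (cop_response gear_strategy r) r"
    by (simp add: c_def)
qed

theorem theorem4p1:
  fixes n :: nat
  assumes "n \<ge> 3"
  shows "cop_number (BW_verts n) (BW_edges n) = 2"
  unfolding cop_number_def
proof (rule Least_equality)
  show "cops_win (BW_verts n) (BW_edges n) 2" by (rule cops_win_2_BW)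
  fix k assume k: "cops_win (BW_verts n) (BW_edges n) k"
  have ne: "BW_verts n \<noteq> {}" by (simp add: BW_verts_def)
  have "\<not> cops_win (BW_verts n) (BW_edges n) 1"
    by (rule not_cops_win_1_if_triangle_free[OF ne BW_two_neighbours BW_triangle_free])
      (use assms in simp_all)
  with k not_cops_win_0[OF ne, of "BW_edges n"] have "k \<noteq> 0 \<and> k \<noteq> 1" by (intro conjI notI) simp_all
  then show "2 \<le> k" by simp
qed

end
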